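(* Let $f:\mathbb{R}^d\to\mathbb{R}$ be $\mu$-strongly convex ($\mu>0$) with $L$-Lipschitz continuous gradient, let $x^*$ be its minimizer, and let $\mathcal{C}$ be an $\omega$-compression operator ($\omega\ge 0$). Run the ACGD algorithm (defined in the context) from $x^0\in\mathbb{R}^d$ with parameters $$\eta_k\equiv\frac1L,\quad p=1+\omega,\quad \theta_k\equiv\frac{p}{p+\sqrt{\mu/L}},\quad \beta_k\equiv\frac{\sqrt{\mu/L}}{p},\quad \gamma_k\equiv\sqrt{\frac{\mu}{L}}.$$ Then the number of iterations performed by ACGD to find an $\epsilon$-solution, i.e. an iterate with $\mathbb{E}[f(x^k)]-f(x^* )\le\epsilon$ (or with $\mathbb{E}[\|x^k-x^*\|^2]\le\epsilon$), is at most $k=O\big((1+\omega)\sqrt{L/\mu}\,\log\frac1\epsilon\big)$. That is: there are an absolute constant $C>0$ and a number $\Delta>0$ depending only on $f$, $L$, $\mu$ and $x^0$ (not on $\epsilon$, $\omega$ or $\mathcal{C}$) such that for every $\epsilon\in(0,\Delta)$ there is an integer $k\ge 0$ with $k\le\big\lceil C(1+\omega)\sqrt{L/\mu}\,\log(\Delta/\epsilon)\big\rceil$ and $\mathbb{E}[f(x^k)]-f(x^* )\le\epsilon$; and the same holds with the criterion $\mathbb{E}[\|x^k-x^*\|^2]\le\epsilon$ in place of $\mathbb{E}[f(x^k)]-f(x^* )\le\epsilon$.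
   Context: $\|\cdot\|$ is the Euclidean norm. $f$ is $\mu$-strongly convex if $f(x)-f(y)-\langle\nabla f(y),x-y\rangle\ge\frac\mu2\|x-y\|^2$ for all $x,y$. A randomized map $\mathcal{C}:\mathbb{R}^d\to\mathbb{R}^d$ is an $\omega$-compression operator if $\mathbb{E}[\mathcal{C}(x)]=x$ and $\mathbb{E}[\|\mathcal{C}(x)-x\|^2]\le\omega\|x\|^2$ for all $x\in\mathbb{R}^d$. ACGD (accelerated compressed gradient descent), with input $x^0$, $\{\eta_k\},\{\theta_k\},\{\beta_k\},\{\gamma_k\}$, $p$: set $z^0=y^0=x^0$, and for $k=0,1,2,\dots$ do 1. $x^k=\theta_k y^k+(1-\theta_k)z^k$; 2. $g^k=\mathcal{C}(\nabla f(x^k))$, where the randomness of $\mathcal{C}$ is drawn afresh at each iteration, independently of the past; 3. $y^{k+1}=x^k-\frac{\eta_k}{p}g^k$; 4. $z^{k+1}=\frac1{\gamma_k}y^{k+1}+\big(\frac1p-\frac1{\gamma_k}\big)y^k+\big(1-\frac1p\big)(1-\beta_k)z^k+\big(1-\frac1p\big)\beta_k x^k$. The expectation is over all the randomness of the algorithm. *)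

theory Defs
  imports "HOL-Probability.Probability"
begin

text \<open>
  The complexity bound has one absolute constant for all dimensions, so the dimension \<open>d\<close> has to be
  a natural number bound inside the statement and not a type. As in
  \<^theory>\<open>HOL-Analysis.Abstract_Euclidean_Space\<close>, \<open>\<real>\<^sup>d\<close> is the set of those real sequences that
  vanish from index \<open>d\<close> on; values of functions outside this set are irrelevant.
\<close>

abbreviation Rd :: "nat \<Rightarrow> (nat \<Rightarrow> real) set" where
  "Rd d \<equiv> topspace (Euclidean_space d)"

definition Rd_borel :: "nat \<Rightarrow> (nat \<Rightarrow> real) measure" where
  "Rd_borel d = restrict_space borel (Rd d)"

definition ip :: "nat \<Rightarrow> (nat \<Rightarrow> real) \<Rightarrow> (nat \<Rightarrow> real) \<Rightarrow> real" where
  "ip d x y = (\<Sum>i<d. x i * y i)"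

definition nrm :: "nat \<Rightarrow> (nat \<Rightarrow> real) \<Rightarrow> real" where
  "nrm d x = L2_set x {..<d}"

definition has_gradient ::
  "nat \<Rightarrow> ((nat \<Rightarrow> real) \<Rightarrow> real) \<Rightarrow> (nat \<Rightarrow> real) \<Rightarrow> (nat \<Rightarrow> real) \<Rightarrow> bool" where
  "has_gradient d f x g \<longleftrightarrow> g \<in> Rd d \<and>
     (\<forall>e>0. \<exists>\<delta>>0. \<forall>y\<in>Rd d. nrm d (y - x) < \<delta> \<longrightarrow>
        \<bar>f y - f x - ip d g (y - x)\<bar> \<le> e * nrm d (y - x))"

definition grad :: "nat \<Rightarrow> ((nat \<Rightarrow> real) \<Rightarrow> real) \<Rightarrow> (nat \<Rightarrow> real) \<Rightarrow> (nat \<Rightarrow> real)" where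
  "grad d f x = (THE g. has_gradient d f x g)"

lemma has_gradient_unique:
  assumes x: "x \<in> Rd d" and g: "has_gradient d f x g" and h: "has_gradient d f x h"
  shows "g = h"
proof (rule ccontr)
  assume ne: "g \<noteq> h"
  define v where "v = g - h"
  have v: "v \<in> Rd d"
    using g h by (auto simp: v_def has_gradient_def topspace_Euclidean_space)
  define n where "n = nrm d v"
  have n0: "n > 0"
  proof -
    obtain i where "g i \<noteq> h i" using ne by auto
    then have "v i \<noteq> 0" by (simp add: v_def)
    then have "i < d" using v by (auto simp: topspace_Euclidean_space not_less[symmetric])
    then have "\<bar>v i\<bar> \<le> n"
      using member_le_L2_set[of "{..<d}" i "\<lambda>i. \<bar>v i\<bar>"]
      by (simp add: n_def nrm_def L2_set_def)
    with \<open>v i \<noteq> 0\<close> show ?thesis by linarith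
  qed
  obtain a where a: "a > 0"
    "\<And>y. \<lbrakk>y \<in> Rd d; nrm d (y - x) < a\<rbrakk> \<Longrightarrow> \<bar>f y - f x - ip d g (y - x)\<bar> \<le> n/4 * nrm d (y - x)"
    using g n0 unfolding has_gradient_def by (metis zero_less_divide_iff zero_less_numeral)
  obtain b where b: "b > 0"
    "\<And>y. \<lbrakk>y \<in> Rd d; nrm d (y - x) < b\<rbrakk> \<Longrightarrow> \<bar>f y - f x - ip d h (y - x)\<bar> \<le> n/4 * nrm d (y - x)"
    using h n0 unfolding has_gradient_def by (metis zero_less_divide_iff zero_less_numeral)
  define t where "t = min a b / (2 * n)"
  have t0: "t > 0" using a(1) b(1) n0 by (simp add: t_def)
  define y where "y = (\<lambda>i. x i + t * v i)"
  have yx: "y - x = (\<lambda>i. t * v i)" by (auto simp: y_def)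
  have y: "y \<in> Rd d" using x v by (auto simp: y_def topspace_Euclidean_space)
  have ny: "nrm d (y - x) = t * n"
    using t0 by (simp add: yx nrm_def n_def L2_set_right_distrib)
  have "t * n < a" "t * n < b"
    using n0 a(1) b(1) by (auto simp: t_def)
  then have 1: "\<bar>f y - f x - ip d g (y - x)\<bar> \<le> n/4 * (t * n)"
    "\<bar>f y - f x - ip d h (y - x)\<bar> \<le> n/4 * (t * n)"
    using a(2)[OF y] b(2)[OF y] by (simp_all add: ny)
  have "ip d g (y - x) - ip d h (y - x) = t * n\<^sup>2"
  proof -
    have "n\<^sup>2 = (\<Sum>i<d. v i * v i)"
      by (simp add: n_def nrm_def L2_set_def sum_nonneg power2_eq_square)
    then show ?thesis
      by (simp add: ip_def yx sum_subtractf[symmetric] sum_distrib_left v_def algebra_simps)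
  qed
  moreover have "t * n\<^sup>2 > 0" using t0 n0 by simp
  moreover have "n/4 * (t * n) = t * n\<^sup>2 / 4" by (simp add: power2_eq_square)
  ultimately show False using 1 by linarith
qed

definition lipschitz_gradient :: "nat \<Rightarrow> real \<Rightarrow> ((nat \<Rightarrow> real) \<Rightarrow> real) \<Rightarrow> bool" where
  "lipschitz_gradient d L f \<longleftrightarrow>
     (\<forall>x\<in>Rd d. \<exists>g. has_gradient d f x g) \<and>
     (\<forall>x\<in>Rd d. \<forall>y\<in>Rd d. nrm d (grad d f x - grad d f y) \<le> L * nrm d (x - y))"

definition strongly_convex :: "nat \<Rightarrow> real \<Rightarrow> ((nat \<Rightarrow> real) \<Rightarrow> real) \<Rightarrow> bool" where
  "strongly_convex d \<mu> f \<longleftrightarrow>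
     (\<forall>x\<in>Rd d. \<forall>y\<in>Rd d. f x - f y - ip d (grad d f y) (x - y) \<ge> \<mu> / 2 * (nrm d (x - y))\<^sup>2)"

text \<open>
  A randomized map is a Markov kernel: \<open>\<C> x\<close> is the law of the random vector \<open>\<C>(x)\<close>.
  Integrability is required explicitly because the integral of a non-integrable function is \<open>0\<close>.
\<close>

definition compression_operator ::
  "nat \<Rightarrow> real \<Rightarrow> ((nat \<Rightarrow> real) \<Rightarrow> (nat \<Rightarrow> real) measure) \<Rightarrow> bool" where
  "compression_operator d \<omega> \<C> \<longleftrightarrow>
     \<C> \<in> Rd_borel d \<rightarrow>\<^sub>M prob_algebra (Rd_borel d) \<and>
     (\<forall>x\<in>Rd d.
        (\<forall>i<d. integrable (\<C> x) (\<lambda>g. g i) \<and> (\<integral>g. g i \<partial>\<C> x) = x i) \<and>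
        integrable (\<C> x) (\<lambda>g. (nrm d (g - x))\<^sup>2) \<and>
        (\<integral>g. (nrm d (g - x))\<^sup>2 \<partial>\<C> x) \<le> \<omega> * (nrm d x)\<^sup>2)"

definition acgd_x :: "real \<Rightarrow> (nat \<Rightarrow> real) \<times> (nat \<Rightarrow> real) \<Rightarrow> (nat \<Rightarrow> real)" where
  "acgd_x \<theta> = (\<lambda>(y, z) i. \<theta> * y i + (1 - \<theta>) * z i)"

text \<open>
  \<open>acgd_yz d f \<C> \<eta> \<theta> \<beta> \<gamma> p x0 k\<close> is the joint law of \<open>(y\<^sup>k, z\<^sup>k)\<close>. Given \<open>(y\<^sup>k, z\<^sup>k)\<close>, the vector
  \<open>g\<^sup>k\<close> is drawn from \<open>\<C> (\<nabla>f(x\<^sup>k))\<close>; the monadic bind expresses that this draw uses fresh randomness.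
\<close>

primrec acgd_yz ::
  "nat \<Rightarrow> ((nat \<Rightarrow> real) \<Rightarrow> real) \<Rightarrow> ((nat \<Rightarrow> real) \<Rightarrow> (nat \<Rightarrow> real) measure) \<Rightarrow>
   (nat \<Rightarrow> real) \<Rightarrow> (nat \<Rightarrow> real) \<Rightarrow> (nat \<Rightarrow> real) \<Rightarrow> (nat \<Rightarrow> real) \<Rightarrow> real \<Rightarrow> (nat \<Rightarrow> real) \<Rightarrow>
   nat \<Rightarrow> ((nat \<Rightarrow> real) \<times> (nat \<Rightarrow> real)) measure" where
  "acgd_yz d f \<C> \<eta> \<theta> \<beta> \<gamma> p x0 0 = return (Rd_borel d \<Otimes>\<^sub>M Rd_borel d) (x0, x0)"
| "acgd_yz d f \<C> \<eta> \<theta> \<beta> \<gamma> p x0 (Suc k) =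
     acgd_yz d f \<C> \<eta> \<theta> \<beta> \<gamma> p x0 k \<bind> (\<lambda>(y, z).
       let x = acgd_x (\<theta> k) (y, z) in
       \<C> (grad d f x) \<bind> (\<lambda>g.
         let y' = (\<lambda>i. x i - \<eta> k / p * g i);
             z' = (\<lambda>i. 1 / \<gamma> k * y' i + (1 / p - 1 / \<gamma> k) * y i
                       + (1 - 1 / p) * (1 - \<beta> k) * z i + (1 - 1 / p) * \<beta> k * x i)
         in return (Rd_borel d \<Otimes>\<^sub>M Rd_borel d) (y', z')))"

text \<open>The law of the iterate \<open>x\<^sup>k\<close>.\<close>

definition acgd ::
  "nat \<Rightarrow> ((nat \<Rightarrow> real) \<Rightarrow> real) \<Rightarrow> ((nat \<Rightarrow> real) \<Rightarrow> (nat \<Rightarrow> real) measure) \<Rightarrow>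
   (nat \<Rightarrow> real) \<Rightarrow> (nat \<Rightarrow> real) \<Rightarrow> (nat \<Rightarrow> real) \<Rightarrow> (nat \<Rightarrow> real) \<Rightarrow> real \<Rightarrow> (nat \<Rightarrow> real) \<Rightarrow>
   nat \<Rightarrow> (nat \<Rightarrow> real) measure" where
  "acgd d f \<C> \<eta> \<theta> \<beta> \<gamma> p x0 k =
     distr (acgd_yz d f \<C> \<eta> \<theta> \<beta> \<gamma> p x0 k) (Rd_borel d) (acgd_x (\<theta> k))"

text \<open>The law of \<open>x\<^sup>k\<close> for the parameters \<open>\<eta>\<close>, \<open>\<theta>\<close>, \<open>\<beta>\<close>, \<open>\<gamma>\<close>, \<open>p\<close> of the complexity theorem.\<close>

definition acgd_tuned ::
  "nat \<Rightarrow> ((nat \<Rightarrow> real) \<Rightarrow> real) \<Rightarrow> real \<Rightarrow> real \<Rightarrow> (nat \<Rightarrow> real) \<Rightarrow>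
   real \<Rightarrow> ((nat \<Rightarrow> real) \<Rightarrow> (nat \<Rightarrow> real) measure) \<Rightarrow> nat \<Rightarrow> (nat \<Rightarrow> real) measure" where
  "acgd_tuned d f L \<mu> x0 \<omega> \<C> =
     (let p = 1 + \<omega> in
      acgd d f \<C> (\<lambda>k. 1 / L) (\<lambda>k. p / (p + sqrt (\<mu> / L))) (\<lambda>k. sqrt (\<mu> / L) / p)
        (\<lambda>k. sqrt (\<mu> / L)) p x0)"

end

theory Submission
  imports Defs
begin

text \<open>
  Put \<open>s = sqrt (\<mu> / L)\<close> and \<open>a = s / p\<close>. For the tuned parameters \<open>y\<^sup>k\<close> cancels from the update of
  \<open>z\<close>, which becomes \<open>z\<^sup>k\<^sup>+\<^sup>1 = (1 - a) z\<^sup>k + a x\<^sup>k - (a / \<mu>) g\<^sup>k\<close>, while \<open>a (z\<^sup>k - x\<^sup>k) = x\<^sup>k - y\<^sup>k\<close>.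
  The potential \<open>f (y) - f (x\<^sup>*) + \<mu> / 2 * \<parallel>z - x\<^sup>*\<parallel>\<^sup>2\<close> then contracts in expectation by the factor
  \<open>1 - a\<close> in each iteration: the second moment of the compressed gradient is at most \<open>p\<close> times the
  squared gradient, which the descent lemma absorbs, and the cross terms are bounded by strong
  convexity. Up to factors depending on \<open>L\<close> and \<open>\<mu>\<close> only, which go into \<open>\<Delta>\<close>, the potential
  dominates both error criteria at \<open>x\<^sup>k\<close>.
\<close>

section \<open>Inner product and norm on the first \<open>d\<close> coordinates\<close>

lemma nrm_squared: "(nrm d x)\<^sup>2 = ip d x x"
  by (simp add: nrm_def L2_set_def ip_def sum_nonneg power2_eq_square)

lemma nrm_nonneg [simp]: "0 \<le> nrm d x"
  by (simp add: nrm_def)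

lemma nrm_scale: "nrm d (\<lambda>i. c * x i) = \<bar>c\<bar> * nrm d x"
proof -
  have "L2_set (\<lambda>i. \<bar>c\<bar> * \<bar>x i\<bar>) {..<d} = \<bar>c\<bar> * L2_set (\<lambda>i. \<bar>x i\<bar>) {..<d}"
    by (simp add: L2_set_right_distrib)
  then show ?thesis by (simp add: nrm_def L2_set_def power_mult_distrib)
qed

lemma ip_le_nrm_mult: "ip d x y \<le> nrm d x * nrm d y"
proof -
  have "ip d x y \<le> (\<Sum>i<d. \<bar>x i\<bar> * \<bar>y i\<bar>)"
    unfolding ip_def by (intro sum_mono) (metis abs_ge_self abs_mult)
  also have "\<dots> \<le> nrm d x * nrm d y"
    unfolding nrm_def by (rule L2_set_mult_ineq)
  finally show ?thesis .
qed

lemma abs_le_nrm: "i < d \<Longrightarrow> \<bar>x i\<bar> \<le> nrm d x"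
  using member_le_L2_set[of "{..<d}" i "\<lambda>i. \<bar>x i\<bar>"] by (simp add: nrm_def L2_set_def)

lemma ip_diff_left: "ip d (x - y) z = ip d x z - ip d y z"
  by (simp add: ip_def sum_subtractf algebra_simps)

lemma ip_scale_right: "ip d x (\<lambda>i. c * y i) = c * ip d x y"
  by (simp add: ip_def sum_distrib_left algebra_simps)

lemma Rd_iff: "x \<in> Rd d \<longleftrightarrow> (\<forall>i\<ge>d. x i = 0)"
  by (simp add: topspace_Euclidean_space)

text \<open>Reduces the gradient to an ordinary derivative along a line, so that one-variable
  calculus applies on segments. The line stays inside \<open>Rd d\<close>, the only place where
  \<open>has_gradient\<close> controls \<open>f\<close>.\<close>

lemma has_gradient_line_deriv:
  assumes g: "has_gradient d f (\<lambda>i. x i + t * v i) g" and x: "x \<in> Rd d" and v: "v \<in> Rd d"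
  shows "((\<lambda>t. f (\<lambda>i. x i + t * v i)) has_real_derivative ip d g v) (at t)"
proof -
  let ?p = "\<lambda>t i. x i + t * v i"
  have "((\<lambda>h. (f (?p (t + h)) - f (?p t)) / h) \<longlongrightarrow> ip d g v) (at 0)"
    unfolding tendsto_iff eventually_at dist_real_def
  proof (intro allI impI)
    fix e :: real assume e: "0 < e"
    \<comment> \<open>The summand 1 avoids division by zero when \<open>v\<close> vanishes; the
      factor 2 leaves room for a strict inequality.\<close>
    define e' where "e' = e / (2 * (nrm d v + 1))"
    have n: "nrm d v + 1 > 0" by (simp add: add_nonneg_pos)
    have e': "0 < e'" using e n by (simp add: e'_def)
    have *: "e' * nrm d v < e"
    proof -
      have "e' * nrm d v \<le> e' * (nrm d v + 1)" using e' by (intro mult_left_mono) auto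
      also have "\<dots> = e / 2" using n by (simp add: e'_def field_simps)
      finally show ?thesis using e by linarith
    qed
    obtain \<delta> where \<delta>: "\<delta> > 0" "\<And>y. y \<in> Rd d \<Longrightarrow> nrm d (y - ?p t) < \<delta> \<Longrightarrow>
        \<bar>f y - f (?p t) - ip d g (y - ?p t)\<bar> \<le> e' * nrm d (y - ?p t)"
      using g e' unfolding has_gradient_def by blast
    have "\<bar>(f (?p (t + h)) - f (?p t)) / h - ip d g v\<bar> < e"
      if h: "h \<noteq> 0" "\<bar>h - 0\<bar> < \<delta> / (nrm d v + 1)" for h
    proof -
      have eq: "?p (t + h) - ?p t = (\<lambda>i. h * v i)" by (auto simp: algebra_simps)
      have "\<bar>h\<bar> * nrm d v \<le> \<bar>h\<bar> * (nrm d v + 1)" by (intro mult_left_mono) auto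
      also have "\<dots> < \<delta>" using h n by (simp add: field_simps)
      finally have "nrm d (?p (t + h) - ?p t) < \<delta>" by (simp only: eq nrm_scale)
      moreover have "?p (t + h) \<in> Rd d" using x v by (simp add: Rd_iff)
      ultimately have "\<bar>f (?p (t + h)) - f (?p t) - h * ip d g v\<bar> \<le> e' * (\<bar>h\<bar> * nrm d v)"
        using \<delta>(2)[of "?p (t + h)"] by (simp only: eq nrm_scale ip_scale_right)
      moreover have "(f (?p (t + h)) - f (?p t)) / h - ip d g v
          = (f (?p (t + h)) - f (?p t) - h * ip d g v) / h"
        using h by (simp add: field_simps)
      ultimately have "\<bar>(f (?p (t + h)) - f (?p t)) / h - ip d g v\<bar> \<le> e' * nrm d v"
        using h by (simp add: abs_divide field_simps)
      with * show ?thesis by linarith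
    qed
    then show "\<exists>r>0. \<forall>h\<in>UNIV. h \<noteq> 0 \<and> \<bar>h - 0\<bar> < r \<longrightarrow>
        \<bar>(f (?p (t + h)) - f (?p t)) / h - ip d g v\<bar> < e"
      using \<delta>(1) n by (intro exI[of _ "\<delta> / (nrm d v + 1)"]) auto
  qed
  then show ?thesis by (simp add: DERIV_def)
qed

section \<open>Topology and Borel sets through coordinates\<close>

lemma tendsto_Rd_coordinate: "((\<lambda>y::nat \<Rightarrow> real. y i) \<longlongrightarrow> x i) (at x within S)"
  by (metis UNIV_I continuous_on continuous_on_product_coordinates tendsto_within_subset subset_UNIV)

lemma space_Rd_borel [simp]: "space (Rd_borel d) = Rd d"
  by (simp add: Rd_borel_def space_restrict_space)

lemma measurable_Rd_coordinate [measurable]: "(\<lambda>x. x i) \<in> borel_measurable (Rd_borel d)"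
  unfolding Rd_borel_def by (intro measurable_restrict_space1 measurable_product_coordinates)

lemma measurable_compose_Rd_coordinate [measurable (raw)]:
  "h \<in> M \<rightarrow>\<^sub>M Rd_borel d \<Longrightarrow> (\<lambda>x. h x i) \<in> borel_measurable M"
  by (rule measurable_compose[OF _ measurable_Rd_coordinate])

text \<open>The Borel sets of the product topology on real sequences are generated by the countably
  many coordinates, so measurability can be checked one coordinate at a time.\<close>

lemma measurable_Rd_borelI:
  assumes "\<And>i. (\<lambda>x. h x i) \<in> borel_measurable M" and "\<And>x. x \<in> space M \<Longrightarrow> h x \<in> Rd d"
  shows "h \<in> M \<rightarrow>\<^sub>M Rd_borel d"
  unfolding Rd_borel_def
  using assms by (intro measurable_restrict_space2 measurable_coordinatewise_then_product) auto

section \<open>Inequalities for smooth strongly convex functions\<close>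

locale smooth_strongly_convex =
  fixes d :: nat and f :: "(nat \<Rightarrow> real) \<Rightarrow> real" and L \<mu> :: real and xstar :: "nat \<Rightarrow> real"
  assumes dim_pos: "0 < d" and mu_pos: "0 < \<mu>"
    and lip: "lipschitz_gradient d L f" and sc: "strongly_convex d \<mu> f"
    and xstar: "xstar \<in> Rd d" and minimizer: "\<And>x. x \<in> Rd d \<Longrightarrow> f xstar \<le> f x"
begin

lemma has_grad: "x \<in> Rd d \<Longrightarrow> has_gradient d f x (grad d f x)"
  using lip has_gradient_unique unfolding lipschitz_gradient_def grad_def
  by (metis (mono_tags, lifting) theI')

lemma grad_Rd: "x \<in> Rd d \<Longrightarrow> grad d f x \<in> Rd d"
  using has_grad unfolding has_gradient_def by blast

lemma grad_lipschitz:
  "x \<in> Rd d \<Longrightarrow> y \<in> Rd d \<Longrightarrow> nrm d (grad d f x - grad d f y) \<le> L * nrm d (x - y)"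
  using lip unfolding lipschitz_gradient_def by blast

lemma strong_convexity:
  "x \<in> Rd d \<Longrightarrow> y \<in> Rd d \<Longrightarrow>
    f y + ip d (grad d f y) (x - y) + \<mu> / 2 * (nrm d (x - y))\<^sup>2 \<le> f x"
  using sc unfolding strongly_convex_def by force

text \<open>Up to the constant \<open>f x\<close>, the function \<open>?\<phi>\<close> is the left
  side minus the right side along the segment from \<open>x\<close> to \<open>y\<close>.
  Cauchy-Schwarz and the Lipschitz bound at distance \<open>t * nrm d v\<close> make its derivative
  nonpositive, so comparing the endpoints suffices and no gradient has to be integrated.\<close>

lemma descent:
  assumes x: "x \<in> Rd d" and y: "y \<in> Rd d"
  shows "f y \<le> f x + ip d (grad d f x) (y - x) + L / 2 * (nrm d (y - x))\<^sup>2"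
proof -
  define v where "v = y - x"
  have v: "v \<in> Rd d" using x y by (simp add: v_def Rd_iff)
  let ?p = "\<lambda>t i. x i + t * v i"
  let ?\<phi> = "\<lambda>t. f (?p t) - t * ip d (grad d f x) v - L / 2 * t\<^sup>2 * (nrm d v)\<^sup>2"
  have p: "?p t \<in> Rd d" for t using x v by (simp add: Rd_iff)
  have "?\<phi> 1 \<le> ?\<phi> 0"
  proof (rule DERIV_nonpos_imp_nonincreasing[where f = ?\<phi>])
    fix t :: real assume t: "0 \<le> t" "t \<le> 1"
    have "(?\<phi> has_real_derivative
        ip d (grad d f (?p t)) v - ip d (grad d f x) v - L * t * (nrm d v)\<^sup>2) (at t)"
      using has_gradient_line_deriv[OF has_grad[OF p] x v, of t]
      by (auto intro!: derivative_eq_intros)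
    moreover have "ip d (grad d f (?p t)) v - ip d (grad d f x) v \<le> L * t * (nrm d v)\<^sup>2"
    proof -
      have "ip d (grad d f (?p t)) v - ip d (grad d f x) v
          \<le> nrm d (grad d f (?p t) - grad d f x) * nrm d v"
        by (metis ip_diff_left ip_le_nrm_mult)
      also have "\<dots> \<le> (L * nrm d (?p t - x)) * nrm d v"
        by (intro mult_right_mono grad_lipschitz p x nrm_nonneg)
      also have "?p t - x = (\<lambda>i. t * v i)" by auto
      finally show ?thesis using t by (simp add: nrm_scale power2_eq_square)
    qed
    ultimately show "\<exists>y. (?\<phi> has_real_derivative y) (at t) \<and> y \<le> 0" by force
  qed simp
  moreover have "?p 1 = y" "?p 0 = x" by (auto simp: v_def)
  ultimately show ?thesis by (simp add: v_def)
qed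

text \<open>Positive dimension supplies a unit vector. Along it the quadratic upper and lower bounds
  at \<open>xstar\<close> share their linear term, and comparing them leaves the two constants.
  Positivity of \<open>L\<close> is derived from this.\<close>

lemma mu_le_L: "\<mu> \<le> L"
proof -
  define e :: "nat \<Rightarrow> real" where "e = (\<lambda>i. if i = 0 then 1 else 0)"
  define y where "y = (\<lambda>i. xstar i + e i)"
  have y: "y \<in> Rd d" using xstar dim_pos by (auto simp: y_def Rd_iff e_def)
  have "y - xstar = e" by (auto simp: y_def)
  moreover have "(nrm d e)\<^sup>2 = 1"
    using dim_pos by (simp add: nrm_squared ip_def e_def if_distrib sum.delta cong: if_cong)
  ultimately show ?thesis
    using descent[OF xstar y] strong_convexity[OF y xstar] by simp
qed

lemma L_pos: "0 < L"
  using mu_le_L mu_pos by simp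

text \<open>A gradient step of length \<open>1 / L\<close> from \<open>xstar\<close> would decrease
  the objective by at least \<open>(nrm d g)\<^sup>2 / (2 * L)\<close>, which minimality excludes
  unless the gradient vanishes.\<close>

lemma grad_xstar: "ip d (grad d f xstar) v = 0"
proof -
  define g where "g = grad d f xstar"
  define y where "y = (\<lambda>i. xstar i - 1 / L * g i)"
  have gR: "g \<in> Rd d" using grad_Rd[OF xstar] by (simp add: g_def)
  have y: "y \<in> Rd d" using gR xstar by (simp add: y_def Rd_iff)
  have eq: "y - xstar = (\<lambda>i. (- 1 / L) * g i)" by (auto simp: y_def)
  have "f xstar \<le> f xstar + (- 1 / L) * (nrm d g)\<^sup>2 + L / 2 * (\<bar>- 1 / L\<bar> * nrm d g)\<^sup>2"
    using descent[OF xstar y] minimizer[OF y]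
    by (simp only: eq ip_scale_right nrm_scale nrm_squared g_def)
  then have "(nrm d g)\<^sup>2 \<le> 0"
    using L_pos by (simp add: power_mult_distrib power_divide field_simps power2_eq_square)
  then have "nrm d g = 0" by simp
  then have "\<forall>i<d. g i = 0" using abs_le_nrm[of _ d g] by fastforce
  then show ?thesis by (simp add: ip_def g_def)
qed

lemma gap_le: "x \<in> Rd d \<Longrightarrow> f x - f xstar \<le> L / 2 * (nrm d (x - xstar))\<^sup>2"
  using descent[OF xstar, of x] by (simp add: grad_xstar)

lemma gap_ge: "x \<in> Rd d \<Longrightarrow> \<mu> / 2 * (nrm d (x - xstar))\<^sup>2 \<le> f x - f xstar"
  using strong_convexity[of x xstar] xstar by (simp add: grad_xstar)

section \<open>Continuity and measurability of the objective and its gradient\<close>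

lemma continuous_on_objective: "continuous_on (Rd d) f"
  unfolding continuous_on
proof
  fix x assume x: "x \<in> Rd d"
  let ?F = "at x within Rd d"
  let ?g = "grad d f x"
  have c: "((\<lambda>y. y i) \<longlongrightarrow> x i) ?F" for i
    by (rule tendsto_Rd_coordinate)
  \<comment> \<open>The objective is squeezed between the affine minorant from strong convexity and
    the quadratic majorant from \<open>descent\<close>. Both limits are first obtained in
    unsimplified form, with factors \<open>x i - x i\<close> that then vanish.\<close>
  have "((\<lambda>y. f x + ip d ?g (y - x)) \<longlongrightarrow> f x + (\<Sum>i<d. ?g i * (x i - x i))) ?F"
    unfolding ip_def fun_diff_def by (intro tendsto_intros c)
  then have lower: "((\<lambda>y. f x + ip d ?g (y - x)) \<longlongrightarrow> f x) ?F"
    by simp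
  have "((\<lambda>y. f x + ip d ?g (y - x) + L / 2 * (nrm d (y - x))\<^sup>2) \<longlongrightarrow>
      f x + (\<Sum>i<d. ?g i * (x i - x i)) + L / 2 * (\<Sum>i<d. (x i - x i) * (x i - x i))) ?F"
    unfolding ip_def fun_diff_def nrm_squared by (intro tendsto_intros c)
  then have upper:
    "((\<lambda>y. f x + ip d ?g (y - x) + L / 2 * (nrm d (y - x))\<^sup>2) \<longlongrightarrow> f x) ?F"
    by simp
  have "f x + ip d ?g (y - x) \<le> f y" if "y \<in> Rd d" for y
  proof -
    have "0 \<le> \<mu> / 2 * (nrm d (y - x))\<^sup>2" using mu_pos by simp
    then show ?thesis using strong_convexity[OF that x] by linarith
  qed
  then have "\<forall>\<^sub>F y in ?F. f x + ip d ?g (y - x) \<le> f y"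
    by (auto simp: eventually_at_filter)
  moreover have "\<forall>\<^sub>F y in ?F. f y \<le> f x + ip d ?g (y - x) + L / 2 * (nrm d (y - x))\<^sup>2"
    using descent[OF x] by (auto simp: eventually_at_filter)
  ultimately show "(f \<longlongrightarrow> f x) ?F"
    by (rule tendsto_sandwich[OF _ _ lower upper])
qed

lemma continuous_on_grad: "continuous_on (Rd d) (\<lambda>x. grad d f x i)"
proof (cases "i < d")
  case False
  then have "grad d f x i = 0" if "x \<in> Rd d" for x
    using grad_Rd[OF that] by (simp add: Rd_iff)
  then show ?thesis by (simp cong: continuous_on_cong)
next
  case True
  show ?thesis
    unfolding continuous_on
  proof
    fix x assume x: "x \<in> Rd d"
    let ?F = "at x within Rd d"
    have "((\<lambda>y. L * nrm d (y - x)) \<longlongrightarrow> L * sqrt (\<Sum>i<d. (x i - x i)\<^sup>2)) ?F"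
      unfolding nrm_def L2_set_def fun_diff_def by (intro tendsto_intros tendsto_Rd_coordinate)
    then have lim: "((\<lambda>y. L * nrm d (y - x)) \<longlongrightarrow> 0) ?F"
      by simp
    have bound: "\<bar>grad d f y i - grad d f x i\<bar> \<le> L * nrm d (y - x)" if "y \<in> Rd d" for y
      using abs_le_nrm[OF True, of "grad d f y - grad d f x"] grad_lipschitz[OF that x] by simp
    have "((\<lambda>y. grad d f y i - grad d f x i) \<longlongrightarrow> 0) ?F"
      by (rule Lim_null_comparison[OF _ lim])
        (use bound in \<open>auto simp: eventually_at_filter\<close>)
    then show "((\<lambda>y. grad d f y i) \<longlongrightarrow> grad d f x i) ?F"
      by (rule LIM_zero_cancel)
  qed
qed

lemma measurable_objective: "f \<in> borel_measurable (Rd_borel d)"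
  unfolding Rd_borel_def
  by (rule borel_measurable_continuous_on_restrict[OF continuous_on_objective])

lemma measurable_grad: "grad d f \<in> Rd_borel d \<rightarrow>\<^sub>M Rd_borel d"
proof (rule measurable_Rd_borelI)
  show "(\<lambda>x. grad d f x i) \<in> borel_measurable (Rd_borel d)" for i
    unfolding Rd_borel_def
    by (rule borel_measurable_continuous_on_restrict[OF continuous_on_grad])
qed (simp add: grad_Rd)

end

section \<open>Algebra of the iteration with tuned parameters\<close>

locale tuned_acgd = smooth_strongly_convex +
  fixes x0 :: "nat \<Rightarrow> real" and \<omega> :: real and \<C> :: "(nat \<Rightarrow> real) \<Rightarrow> (nat \<Rightarrow> real) measure"
  assumes x0: "x0 \<in> Rd d" and omega_nonneg: "0 \<le> \<omega>"
    and compr: "compression_operator d \<omega> \<C>"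
begin

definition p where "p = 1 + \<omega>"
definition s where "s = sqrt (\<mu> / L)"
definition a where "a = s / p"

lemma p_ge_1: "1 \<le> p"
  using omega_nonneg by (simp add: p_def)

lemma s_pos: "0 < s" and s_le_1: "s \<le> 1" and s_squared: "s * s = \<mu> / L"
  using mu_pos mu_le_L L_pos by (simp_all add: s_def)

lemma a_pos: "0 < a" and a_le_1: "a \<le> 1"
  using s_pos s_le_1 p_ge_1 by (simp_all add: a_def)

abbreviation MM where "MM \<equiv> Rd_borel d \<Otimes>\<^sub>M Rd_borel d"

definition query where "query = acgd_x (p / (p + s))"

text \<open>The second component is already the simplified form of the new \<open>z\<close>, in
  which the old \<open>y\<close> enters only through \<open>query\<close>; \<open>z_update\<close>
  identifies it with the expression used by the algorithm.\<close>

definition update :: "(nat \<Rightarrow> real) \<times> (nat \<Rightarrow> real) \<Rightarrow> (nat \<Rightarrow> real) \<Rightarrow> (nat \<Rightarrow> real) \<times> (nat \<Rightarrow> real)"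
  where "update w g = (\<lambda>i. query w i - 1 / (L * p) * g i,
    \<lambda>i. (1 - a) * snd w i + a * query w i - a / \<mu> * g i)"

definition yz where
  "yz = acgd_yz d f \<C> (\<lambda>k. 1 / L) (\<lambda>k. p / (p + s)) (\<lambda>k. s / p) (\<lambda>k. s) p x0"

lemma query_eq: "query w i = p / (p + s) * fst w i + s / (p + s) * snd w i"
proof -
  have "1 - p / (p + s) = s / (p + s)"
    using s_pos p_ge_1 by (simp add: field_simps)
  then show ?thesis by (simp add: query_def acgd_x_def case_prod_unfold)
qed

text \<open>This is the relation \<open>(p + s) * x = p * y + s * z\<close> divided by
  \<open>p\<close>. It eliminates \<open>y\<close> from the update of \<open>z\<close> and later
  splits the cross term of the potential.\<close>

lemma query_y: "query w i - fst w i = a * (snd w i - query w i)"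
proof -
  have n: "p + s \<noteq> 0" "p \<noteq> 0" using s_pos p_ge_1 by auto
  have "query w i = (p * fst w i + s * snd w i) / (p + s)"
    by (simp add: query_eq add_divide_distrib)
  then have "query w i * (p + s) = p * fst w i + s * snd w i"
    using n by simp
  then show ?thesis using n by (simp add: a_def field_simps)
qed

text \<open>By \<open>query_y\<close> the \<open>1 / s\<close> multiple of \<open>x - y\<close> is
  the \<open>1 / p\<close> multiple of \<open>z - x\<close>, and \<open>s * s = \<mu> / L\<close>
  turns the coefficient \<open>1 / (s * L * p)\<close> of the gradient into
  \<open>a / \<mu>\<close>.\<close>

lemma z_update:
  "1 / s * (query w i - 1 / L / p * t) + (1 / p - 1 / s) * fst w i
     + (1 - 1 / p) * (1 - s / p) * snd w i + (1 - 1 / p) * (s / p) * query w i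
   = (1 - a) * snd w i + a * query w i - a / \<mu> * t"
proof -
  have n: "p \<noteq> 0" "s \<noteq> 0" "L \<noteq> 0" "\<mu> \<noteq> 0" using s_pos p_ge_1 L_pos mu_pos by auto
  \<comment> \<open>Hiding the reciprocals makes the goal a polynomial identity modulo
    \<open>v * s = 1\<close>.\<close>
  define u v c where "u = 1 / p" and "v = 1 / s" and "c = 1 / L / p * t"
  have vs: "v * s = 1" using n by (simp add: v_def)
  have a: "a = s * u" by (simp add: a_def u_def)
  have "\<mu> = s * s * L" using s_squared n by (simp add: field_simps)
  then have ct: "a / \<mu> * t = v * c" using n by (simp add: a_def v_def c_def field_simps)
  have y: "fst w i = query w i - s * u * (snd w i - query w i)"
    using query_y[of w i] by (simp add: a)
  have "(u - v) * fst w i = u * (query w i - s * u * (snd w i - query w i))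
      - v * query w i + (v * s) * u * (snd w i - query w i)"
    unfolding y by (simp only: algebra_simps)
  then have uv: "(u - v) * fst w i = u * (query w i - s * u * (snd w i - query w i))
      - v * query w i + u * (snd w i - query w i)"
    by (simp add: vs)
  have "v * (query w i - c) + (u - v) * fst w i
     + (1 - u) * (1 - s * u) * snd w i + (1 - u) * (s * u) * query w i
   = (1 - s * u) * snd w i + s * u * query w i - v * c"
    unfolding uv by (simp add: algebra_simps)
  then show ?thesis
    unfolding ct unfolding a by (simp add: u_def v_def c_def)
qed

lemma yz_Suc: "yz (Suc k) = yz k \<bind>
    (\<lambda>w. \<C> (grad d f (query w)) \<bind> (\<lambda>g. return MM (update w g)))"
proof -
  have "yz (Suc k) = yz k \<bind> (\<lambda>w. \<C> (grad d f (query w)) \<bind> (\<lambda>g. return MM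
     (\<lambda>i. query w i - 1 / L / p * g i,
      \<lambda>i. 1 / s * (query w i - 1 / L / p * g i) + (1 / p - 1 / s) * fst w i
         + (1 - 1 / p) * (1 - s / p) * snd w i + (1 - 1 / p) * (s / p) * query w i)))"
    by (simp add: yz_def query_def Let_def case_prod_unfold)
  then show ?thesis
    by (simp only: z_update update_def) simp
qed

section \<open>Markov kernel of one iteration and its expectation\<close>

lemma space_MM: "space MM = Rd d \<times> Rd d"
  by (simp add: space_pair_measure)

lemma query_Rd: "w \<in> Rd d \<times> Rd d \<Longrightarrow> query w \<in> Rd d"
  by (auto simp: query_eq Rd_iff)

lemma update_Rd: "w \<in> Rd d \<times> Rd d \<Longrightarrow> g \<in> Rd d \<Longrightarrow> update w g \<in> Rd d \<times> Rd d"
  using query_Rd[of w] by (auto simp: update_def Rd_iff)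

lemma measurable_query: "query \<in> MM \<rightarrow>\<^sub>M Rd_borel d"
proof (rule measurable_Rd_borelI)
  show "(\<lambda>w. query w i) \<in> borel_measurable MM" for i
    unfolding query_eq by measurable
qed (simp add: space_MM query_Rd)

lemma measurable_update: "(\<lambda>(w, g). update w g) \<in> MM \<Otimes>\<^sub>M Rd_borel d \<rightarrow>\<^sub>M MM"
  unfolding case_prod_unfold update_def
proof (intro measurable_Pair measurable_Rd_borelI)
  note [measurable] = measurable_query
  let ?N = "MM \<Otimes>\<^sub>M Rd_borel d"
  show "(\<lambda>v. query (fst v) i - 1 / (L * p) * snd v i) \<in> borel_measurable ?N"
    "(\<lambda>v. (1 - a) * snd (fst v) i + a * query (fst v) i - a / \<mu> * snd v i) \<in> borel_measurable ?N"
    for i by measurable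
next
  fix v assume "v \<in> space (MM \<Otimes>\<^sub>M Rd_borel d)"
  then have "update (fst v) (snd v) \<in> Rd d \<times> Rd d"
    by (intro update_Rd) (auto simp: space_pair_measure)
  then show "(\<lambda>i. query (fst v) i - 1 / (L * p) * snd v i) \<in> Rd d"
    "(\<lambda>i. (1 - a) * snd (fst v) i + a * query (fst v) i - a / \<mu> * snd v i) \<in> Rd d"
    by (simp_all add: update_def)
qed

lemma measurable_compressor: "\<C> \<in> Rd_borel d \<rightarrow>\<^sub>M prob_algebra (Rd_borel d)"
  using compr by (simp add: compression_operator_def)

lemma measurable_draw: "(\<lambda>w. \<C> (grad d f (query w))) \<in> MM \<rightarrow>\<^sub>M prob_algebra (Rd_borel d)"
  by (intro measurable_compose[OF measurable_query] measurable_compose[OF measurable_grad]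
      measurable_compressor)

lemma measurable_kernel:
  "(\<lambda>w. \<C> (grad d f (query w)) \<bind> (\<lambda>g. return MM (update w g))) \<in> MM \<rightarrow>\<^sub>M prob_algebra MM"
proof (rule measurable_bind_prob_space2[OF measurable_draw])
  show "(\<lambda>(w, g). return MM (update w g)) \<in> MM \<Otimes>\<^sub>M Rd_borel d \<rightarrow>\<^sub>M prob_algebra MM"
    using measurable_compose[OF measurable_update measurable_return_prob_space]
    by (simp add: case_prod_unfold)
qed

lemma yz_prob: "yz k \<in> space (prob_algebra MM)"
proof (induction k)
  case 0
  then show ?case
    using x0 by (auto simp: yz_def space_prob_algebra space_MM intro!: prob_space_return)
next
  case (Suc k)
  have "(\<lambda>M. M \<bind> (\<lambda>w. \<C> (grad d f (query w)) \<bind> (\<lambda>g. return MM (update w g))))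
      \<in> prob_algebra MM \<rightarrow>\<^sub>M prob_algebra MM"
    by (rule measurable_bind_prob_space[OF _ measurable_kernel]) simp
  from measurable_space[OF this Suc] show ?case by (simp add: yz_Suc)
qed

lemma sets_yz: "sets (yz k) = sets MM"
  using yz_prob[of k] by (simp add: space_prob_algebra)

text \<open>The law of total expectation for one iteration. The nonnegative integral is used so that
  no integrability under \<open>yz\<close> has to be known in advance.\<close>

lemma nn_integral_yz_Suc:
  assumes h: "h \<in> borel_measurable MM"
  shows "(\<integral>\<^sup>+w. h w \<partial>yz (Suc k))
    = (\<integral>\<^sup>+w. (\<integral>\<^sup>+g. h (update w g) \<partial>\<C> (grad d f (query w))) \<partial>yz k)"
proof -
  have K: "(\<lambda>w. \<C> (grad d f (query w)) \<bind> (\<lambda>g. return MM (update w g)))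
      \<in> yz k \<rightarrow>\<^sub>M subprob_algebra MM"
    using measurable_prob_algebraD[OF measurable_kernel]
    by (simp cong: measurable_cong_sets add: sets_yz)
  have "(\<integral>\<^sup>+w. h w \<partial>yz (Suc k)) = (\<integral>\<^sup>+w. (\<integral>\<^sup>+v. h v
      \<partial>(\<C> (grad d f (query w)) \<bind> (\<lambda>g. return MM (update w g)))) \<partial>yz k)"
    unfolding yz_Suc by (rule nn_integral_bind[OF h K])
  also have "\<dots> = (\<integral>\<^sup>+w. (\<integral>\<^sup>+g. h (update w g) \<partial>\<C> (grad d f (query w))) \<partial>yz k)"
  proof (rule nn_integral_cong)
    fix w assume "w \<in> space (yz k)"
    then have w: "w \<in> space MM" by (metis sets_eq_imp_space_eq sets_yz)
    let ?N = "\<C> (grad d f (query w))"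
    have N: "sets ?N = sets (Rd_borel d)"
      using measurable_space[OF measurable_draw w] by (simp add: space_prob_algebra)
    have u: "update w \<in> Rd_borel d \<rightarrow>\<^sub>M MM"
      using measurable_compose[OF measurable_Pair1'[OF w] measurable_update] by simp
    have "(\<lambda>g. return MM (update w g)) \<in> ?N \<rightarrow>\<^sub>M subprob_algebra MM"
      using measurable_compose[OF u return_measurable] N by (simp cong: measurable_cong_sets)
    from nn_integral_bind[OF h this]
    have "(\<integral>\<^sup>+v. h v \<partial>(?N \<bind> (\<lambda>g. return MM (update w g))))
        = (\<integral>\<^sup>+g. (\<integral>\<^sup>+v. h v \<partial>return MM (update w g)) \<partial>?N)" .
    also have "\<dots> = (\<integral>\<^sup>+g. h (update w g) \<partial>?N)"
      using measurable_space[OF u] sets_eq_imp_space_eq[OF N]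
      by (intro nn_integral_cong nn_integral_return h) auto
    finally show "(\<integral>\<^sup>+v. h v \<partial>(?N \<bind> (\<lambda>g. return MM (update w g))))
        = (\<integral>\<^sup>+g. h (update w g) \<partial>?N)" .
  qed
  finally show ?thesis .
qed

section \<open>One-step contraction of the potential\<close>

definition potential :: "(nat \<Rightarrow> real) \<times> (nat \<Rightarrow> real) \<Rightarrow> real" where
  "potential w = f (fst w) - f xstar + \<mu> / 2 * (nrm d (snd w - xstar))\<^sup>2"

lemma measurable_nrm_diff: "(\<lambda>x. (nrm d (x - v))\<^sup>2) \<in> borel_measurable (Rd_borel d)"
  unfolding nrm_squared ip_def fun_diff_def by measurable

lemma measurable_potential: "potential \<in> borel_measurable MM"
  unfolding potential_def
  by (intro borel_measurable_add borel_measurable_diff borel_measurable_times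
      borel_measurable_const measurable_compose[OF measurable_fst measurable_objective]
      measurable_compose[OF measurable_snd measurable_nrm_diff])

lemma potential_nonneg: "w \<in> Rd d \<times> Rd d \<Longrightarrow> 0 \<le> potential w"
  using minimizer[of "fst w"] mu_pos by (auto simp: potential_def)

text \<open>The second moment comes from the bias-variance decomposition: \<open>q\<close> rewrites
  the squared norm as the squared deviation plus terms affine in \<open>g\<close>. These are
  integrated with the unbiasedness of the compressor, giving the factor
  \<open>\<omega> + 1 = p\<close>.\<close>

lemma compression_moments:
  assumes v: "v \<in> Rd d"
  shows "integrable (\<C> v) (ip d u)" and "(\<integral>g. ip d u g \<partial>\<C> v) = ip d u v"
    and "integrable (\<C> v) (\<lambda>g. (nrm d g)\<^sup>2)" and "(\<integral>g. (nrm d g)\<^sup>2 \<partial>\<C> v) \<le> p * (nrm d v)\<^sup>2"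
proof -
  have c: "integrable (\<C> v) (\<lambda>g. g i)" "(\<integral>g. g i \<partial>\<C> v) = v i" if "i < d" for i
    using compr v that unfolding compression_operator_def by blast+
  have n: "integrable (\<C> v) (\<lambda>g. (nrm d (g - v))\<^sup>2)"
    "(\<integral>g. (nrm d (g - v))\<^sup>2 \<partial>\<C> v) \<le> \<omega> * (nrm d v)\<^sup>2"
    using compr v unfolding compression_operator_def by blast+
  show i: "integrable (\<C> v) (ip d u)" for u
    unfolding ip_def[abs_def] using c by (intro Bochner_Integration.integrable_sum integrable_mult_right) auto
  show e: "(\<integral>g. ip d u g \<partial>\<C> v) = ip d u v" for u
    unfolding ip_def using c by (subst Bochner_Integration.integral_sum) auto
  interpret prob_space "\<C> v"
    using measurable_space[OF measurable_compressor, of v] v by (simp add: space_prob_algebra)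
  define q where "q g = (nrm d (g - v))\<^sup>2 + 2 * ip d v g - (nrm d v)\<^sup>2" for g
  have eq: "(\<lambda>g. (nrm d g)\<^sup>2) = q"
    unfolding q_def nrm_squared ip_def sum_distrib_left sum.distrib[symmetric] sum_subtractf[symmetric]
    by (intro ext sum.cong) (auto simp: algebra_simps)
  show "integrable (\<C> v) (\<lambda>g. (nrm d g)\<^sup>2)"
    unfolding eq q_def using n i by (intro Bochner_Integration.integrable_diff
      Bochner_Integration.integrable_add integrable_mult_right) auto
  have "(\<integral>g. (nrm d g)\<^sup>2 \<partial>\<C> v)
      = (\<integral>g. (nrm d (g - v))\<^sup>2 \<partial>\<C> v) + 2 * ip d v v - (nrm d v)\<^sup>2"
    unfolding eq q_def using n i by (simp add: e prob_space)
  then show "(\<integral>g. (nrm d g)\<^sup>2 \<partial>\<C> v) \<le> p * (nrm d v)\<^sup>2"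
    using n(2) by (simp add: p_def nrm_squared algebra_simps)
qed

text \<open>In each coordinate the two sides differ by
  \<open>t * (1 - t) * (u i - v i)\<^sup>2\<close>.\<close>

lemma nrm_convex_combination:
  assumes "0 \<le> t" "t \<le> 1"
  shows "(nrm d (\<lambda>i. (1 - t) * u i + t * v i))\<^sup>2 \<le> (1 - t) * (nrm d u)\<^sup>2 + t * (nrm d v)\<^sup>2"
proof -
  have "((1 - t) * u i + t * v i) * ((1 - t) * u i + t * v i)
      \<le> (1 - t) * (u i * u i) + t * (v i * v i)" for i
  proof -
    have "(1 - t) * (u i * u i) + t * (v i * v i) - ((1 - t) * u i + t * v i) * ((1 - t) * u i + t * v i)
        = t * (1 - t) * (u i - v i)\<^sup>2"
      by (simp add: algebra_simps power2_eq_square)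
    moreover have "0 \<le> t * (1 - t) * (u i - v i)\<^sup>2" using assms by simp
    ultimately show ?thesis by linarith
  qed
  then show ?thesis
    unfolding nrm_squared ip_def sum_distrib_left sum.distrib[symmetric] by (intro sum_mono)
qed

text \<open>The vector \<open>m\<close> is the new \<open>z\<close> minus \<open>xstar\<close>
  before the gradient is subtracted. By \<open>query_y\<close>, \<open>a * m\<close> splits into
  \<open>a * (x - xstar)\<close> and \<open>(1 - a) * (x - y)\<close>; convexity inequalities at
  \<open>xstar\<close> and at \<open>y\<close> bound the two inner products, and the terms at
  \<open>x\<close> cancel.\<close>

lemma drift_deterministic:
  assumes w: "w \<in> Rd d \<times> Rd d"
  defines "x \<equiv> query w"
  defines "m \<equiv> \<lambda>i. (1 - a) * (snd w - xstar) i + a * (x - xstar) i"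
  shows "f x - f xstar + \<mu> / 2 * (nrm d m)\<^sup>2 - a * ip d m (grad d f x) \<le> (1 - a) * potential w"
proof -
  have x: "x \<in> Rd d" and y: "fst w \<in> Rd d" using w query_Rd[OF w] by (auto simp: x_def)
  have neg: "ip d (grad d f x) (u - x) = - ip d (grad d f x) (x - u)" for u
    by (simp add: ip_def sum_negf[symmetric] algebra_simps)
  have "a * ip d m (grad d f x)
      = a * ip d (grad d f x) (x - xstar) + (1 - a) * ip d (grad d f x) (x - fst w)"
  proof -
    have "a * m i = a * (x - xstar) i + (1 - a) * (x - fst w) i" for i
    proof -
      have "a * m i = a * (x - xstar) i + (1 - a) * (a * (snd w i - query w i))"
        by (simp add: m_def x_def algebra_simps)
      then show ?thesis by (simp only: query_y[symmetric]) (simp add: x_def)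
    qed
    then have "a * (m i * v) = a * (v * (x - xstar) i) + (1 - a) * (v * (x - fst w) i)" for i v
      by (metis (no_types, opaque_lifting) distrib_left mult.assoc mult.commute)
    then show ?thesis
      unfolding ip_def sum_distrib_left sum.distrib[symmetric] by (intro sum.cong) auto
  qed
  \<comment> \<open>The quadratic term of strong convexity is kept here: it cancels the share
    \<open>a\<close> of \<open>(nrm d (x - xstar))\<^sup>2\<close> in the bound for
    \<open>m\<close>. For the direction \<open>x - y\<close> below, plain convexity is
    enough.\<close>
  moreover have "a * (f x - f xstar + \<mu> / 2 * (nrm d (x - xstar))\<^sup>2) \<le> a * ip d (grad d f x) (x - xstar)"
  proof (rule mult_left_mono)
    have "(nrm d (xstar - x))\<^sup>2 = (nrm d (x - xstar))\<^sup>2"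
      by (simp add: nrm_squared ip_def algebra_simps)
    then show "f x - f xstar + \<mu> / 2 * (nrm d (x - xstar))\<^sup>2 \<le> ip d (grad d f x) (x - xstar)"
      using strong_convexity[OF xstar x] neg[of xstar] by simp
  qed (use a_pos in simp)
  moreover have "(1 - a) * (f x - f (fst w)) \<le> (1 - a) * ip d (grad d f x) (x - fst w)"
  proof (rule mult_left_mono)
    have "0 \<le> \<mu> / 2 * (nrm d (fst w - x))\<^sup>2" using mu_pos by simp
    then show "f x - f (fst w) \<le> ip d (grad d f x) (x - fst w)"
      using strong_convexity[OF y x] neg[of "fst w"] by linarith
  qed (use a_le_1 in simp)
  moreover have "\<mu> / 2 * (nrm d m)\<^sup>2
      \<le> \<mu> / 2 * ((1 - a) * (nrm d (snd w - xstar))\<^sup>2 + a * (nrm d (x - xstar))\<^sup>2)"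
    unfolding m_def using a_pos a_le_1 mu_pos
    by (intro mult_left_mono nrm_convex_combination) auto
  ultimately show ?thesis
    by (simp add: potential_def algebra_simps add_divide_distrib diff_divide_distrib)
qed

text \<open>The tuning makes the noise in \<open>z\<close> (coefficient \<open>a\<^sup>2 / (2 \<mu>)\<close>) equal to the noise in \<open>y\<close>
  (coefficient \<open>1 / (2 L p\<^sup>2)\<close>); since the second moment of the compressed gradient is at most
  \<open>p\<close> times the squared gradient, both together are paid for by the linear descent term.\<close>

lemma potential_update:
  assumes w: "w \<in> Rd d \<times> Rd d" and g: "g \<in> Rd d"
  defines "x \<equiv> query w"
  defines "m \<equiv> \<lambda>i. (1 - a) * (snd w - xstar) i + a * (x - xstar) i"
  shows "potential (update w g) \<le> f x - f xstar - 1 / (L * p) * ip d (grad d f x) g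
    + \<mu> / 2 * (nrm d m)\<^sup>2 - a * ip d m g + 1 / (L * p\<^sup>2) * (nrm d g)\<^sup>2"
proof -
  define c where "c = 1 / (L * p)"
  have x: "x \<in> Rd d" using query_Rd[OF w] by (simp add: x_def)
  have y': "fst (update w g) \<in> Rd d" using update_Rd[OF w g] by auto
  have dy: "fst (update w g) - x = (\<lambda>i. (- c) * g i)"
    by (auto simp: update_def x_def c_def)
  have fy: "f (fst (update w g)) \<le> f x - c * ip d (grad d f x) g + L / 2 * c\<^sup>2 * (nrm d g)\<^sup>2"
    using descent[OF x y'] unfolding dy ip_scale_right nrm_scale
    by (simp add: power_mult_distrib)
  have dz: "snd (update w g) - xstar = (\<lambda>i. m i - a / \<mu> * g i)"
    by (auto simp: update_def x_def m_def algebra_simps)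
  have nz: "(nrm d (snd (update w g) - xstar))\<^sup>2
      = (nrm d m)\<^sup>2 - 2 * (a / \<mu>) * ip d m g + (a / \<mu>)\<^sup>2 * (nrm d g)\<^sup>2"
    unfolding dz nrm_squared ip_def sum_distrib_left sum.distrib[symmetric] sum_subtractf[symmetric]
    by (intro sum.cong) (auto simp: algebra_simps power2_eq_square)
  have n: "p \<noteq> 0" "L \<noteq> 0" "\<mu> \<noteq> 0" using p_ge_1 L_pos mu_pos by auto
  have "a\<^sup>2 = \<mu> / L / p\<^sup>2"
    using s_squared by (simp add: a_def power_divide power2_eq_square)
  then have "\<mu> / 2 * (a / \<mu>)\<^sup>2 = 1 / (2 * (L * p\<^sup>2))"
    using n by (simp add: power_divide power2_eq_square)
  moreover have "L / 2 * c\<^sup>2 = 1 / (2 * (L * p\<^sup>2))"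
    using n by (simp add: c_def power2_eq_square)
  ultimately have "L / 2 * c\<^sup>2 * (nrm d g)\<^sup>2 + \<mu> / 2 * (a / \<mu>)\<^sup>2 * (nrm d g)\<^sup>2
      = 1 / (L * p\<^sup>2) * (nrm d g)\<^sup>2"
    by (simp add: field_simps)
  moreover have "\<mu> / 2 * (nrm d (snd (update w g) - xstar))\<^sup>2
      = \<mu> / 2 * (nrm d m)\<^sup>2 - a * ip d m g + \<mu> / 2 * (a / \<mu>)\<^sup>2 * (nrm d g)\<^sup>2"
    unfolding nz using n by (simp add: algebra_simps)
  ultimately show ?thesis
    using fy unfolding potential_def c_def by linarith
qed

text \<open>For a fixed state, the fresh draw replaces \<open>g\<close> by the gradient in the
  linear terms of \<open>potential_update\<close>; the quadratic term is controlled by the second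
  moment, and \<open>drift_deterministic\<close> bounds what is left.\<close>

lemma drift:
  assumes w: "w \<in> Rd d \<times> Rd d"
  shows "(\<integral>\<^sup>+g. ennreal (potential (update w g)) \<partial>\<C> (grad d f (query w)))
    \<le> ennreal ((1 - a) * potential w)"
proof -
  define x v where "x = query w" and "v = grad d f x"
  define m where "m = (\<lambda>i. (1 - a) * (snd w - xstar) i + a * (x - xstar) i)"
  \<comment> \<open>An explicit majorant of the new potential whose integral involves only the first
    and second moments of the draw.\<close>
  define Q where "Q g = f x - f xstar - 1 / (L * p) * ip d v g
    + \<mu> / 2 * (nrm d m)\<^sup>2 - a * ip d m g + 1 / (L * p\<^sup>2) * (nrm d g)\<^sup>2" for g
  have v: "v \<in> Rd d" using grad_Rd query_Rd[OF w] by (simp add: v_def x_def)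
  have N: "sets (\<C> v) = sets (Rd_borel d)" "prob_space (\<C> v)"
    using measurable_space[OF measurable_compressor, of v] v by (simp_all add: space_prob_algebra)
  interpret prob_space "\<C> v" by fact
  have le: "potential (update w g) \<le> Q g" and nonneg: "0 \<le> Q g" if "g \<in> space (\<C> v)" for g
  proof -
    have g: "g \<in> Rd d" using that sets_eq_imp_space_eq[OF N(1)] by simp
    show "potential (update w g) \<le> Q g"
      using potential_update[OF w g] by (simp only: Q_def x_def v_def m_def)
    \<comment> \<open>Nonnegativity is inherited from the potential below it; it allows the
      nonnegative integral of \<open>Q\<close> to be evaluated as a Bochner integral.\<close>
    then show "0 \<le> Q g"
      using potential_nonneg[OF update_Rd[OF w g]] by linarith
  qed
  note mom = compression_moments[OF v]
  have int: "integrable (\<C> v) Q"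
    unfolding Q_def[abs_def] using mom
    by (intro Bochner_Integration.integrable_diff
      Bochner_Integration.integrable_add integrable_mult_right) auto
  have "(\<integral>g. Q g \<partial>\<C> v) = f x - f xstar - 1 / (L * p) * (nrm d v)\<^sup>2
      + \<mu> / 2 * (nrm d m)\<^sup>2 - a * ip d m v + 1 / (L * p\<^sup>2) * (\<integral>g. (nrm d g)\<^sup>2 \<partial>\<C> v)"
    unfolding Q_def using mom by (simp add: prob_space nrm_squared)
  also have "\<dots> \<le> f x - f xstar + \<mu> / 2 * (nrm d m)\<^sup>2 - a * ip d m v"
  proof -
    \<comment> \<open>One factor \<open>p\<close> of the denominator is spent on the second moment;
      the remaining \<open>1 / (L * p)\<close> is exactly the coefficient of the descent
      term.\<close>
    have "1 / (L * p\<^sup>2) * (\<integral>g. (nrm d g)\<^sup>2 \<partial>\<C> v) \<le> 1 / (L * p\<^sup>2) * (p * (nrm d v)\<^sup>2)"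
      using mom(4) L_pos by (intro mult_left_mono) auto
    also have "\<dots> = 1 / (L * p) * (nrm d v)\<^sup>2"
      using p_ge_1 by (simp add: power2_eq_square)
    finally show ?thesis by linarith
  qed
  also have "\<dots> \<le> (1 - a) * potential w"
    using drift_deterministic[OF w] by (simp only: x_def v_def m_def)
  finally have Q: "(\<integral>g. Q g \<partial>\<C> v) \<le> (1 - a) * potential w" .
  have "(\<integral>\<^sup>+g. ennreal (potential (update w g)) \<partial>\<C> v) \<le> (\<integral>\<^sup>+g. ennreal (Q g) \<partial>\<C> v)"
    using le by (intro nn_integral_mono ennreal_leI)
  also have "\<dots> = ennreal (\<integral>g. Q g \<partial>\<C> v)"
    using nonneg by (intro nn_integral_eq_integral int) auto
  also have "\<dots> \<le> ennreal ((1 - a) * potential w)"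
    using Q by (rule ennreal_leI)
  finally show ?thesis by (simp only: v_def x_def)
qed

section \<open>Geometric decay of the expected potential and the error criteria\<close>

lemma expected_potential:
  "(\<integral>\<^sup>+w. ennreal (potential w) \<partial>yz k) \<le> ennreal ((1 - a) ^ k * potential (x0, x0))"
proof (induction k)
  case 0
  have "(x0, x0) \<in> space MM" using x0 by (simp add: space_MM)
  then show ?case
    using measurable_potential by (simp add: yz_def nn_integral_return)
next
  case (Suc k)
  have P: "(\<lambda>w. ennreal (potential w)) \<in> borel_measurable MM"
    using measurable_potential by measurable
  have "(\<integral>\<^sup>+w. ennreal (potential w) \<partial>yz (Suc k))
      \<le> (\<integral>\<^sup>+w. ennreal (1 - a) * ennreal (potential w) \<partial>yz k)"
    unfolding nn_integral_yz_Suc[OF P]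
  proof (rule nn_integral_mono)
    fix w assume "w \<in> space (yz k)"
    then have w: "w \<in> Rd d \<times> Rd d" by (metis sets_eq_imp_space_eq sets_yz space_MM)
    show "(\<integral>\<^sup>+g. ennreal (potential (update w g)) \<partial>\<C> (grad d f (query w)))
        \<le> ennreal (1 - a) * ennreal (potential w)"
      using drift[OF w] a_le_1 potential_nonneg[OF w] by (simp add: ennreal_mult)
  qed
  also have "\<dots> = ennreal (1 - a) * (\<integral>\<^sup>+w. ennreal (potential w) \<partial>yz k)"
    using P by (intro nn_integral_cmult) (simp cong: measurable_cong_sets add: sets_yz)
  also have "\<dots> \<le> ennreal (1 - a) * ennreal ((1 - a) ^ k * potential (x0, x0))"
    by (intro mult_left_mono Suc) simp
  also have "\<dots> = ennreal ((1 - a) ^ Suc k * potential (x0, x0))"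
    using a_le_1 potential_nonneg[of "(x0, x0)"] x0
    by (simp add: ennreal_mult[symmetric] mult.assoc)
  finally show ?case .
qed

lemma distance_query_le_potential:
  assumes w: "w \<in> Rd d \<times> Rd d"
  shows "(nrm d (query w - xstar))\<^sup>2 \<le> 2 / \<mu> * potential w"
proof -
  define t where "t = s / (p + s)"
  have t: "0 \<le> t" "t \<le> 1" using s_pos p_ge_1 by (auto simp: t_def)
  have "p / (p + s) = 1 - t" using s_pos p_ge_1 by (simp add: t_def field_simps)
  then have "query w i = (1 - t) * fst w i + t * snd w i" for i
    by (simp only: query_eq t_def)
  then have "query w - xstar = (\<lambda>i. (1 - t) * (fst w - xstar) i + t * (snd w - xstar) i)"
    by (intro ext) (simp add: algebra_simps)
  then have "(nrm d (query w - xstar))\<^sup>2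
      \<le> (1 - t) * (nrm d (fst w - xstar))\<^sup>2 + t * (nrm d (snd w - xstar))\<^sup>2"
    using nrm_convex_combination[OF t, of "fst w - xstar" "snd w - xstar"] by simp
  \<comment> \<open>The weights depend on \<open>\<omega>\<close>. Replacing them by 1 gives a
    constant free of \<open>\<omega>\<close>, as the choice of \<open>\<Delta>\<close>
    requires.\<close>
  also have "\<dots> \<le> 1 * (nrm d (fst w - xstar))\<^sup>2 + 1 * (nrm d (snd w - xstar))\<^sup>2"
    using t by (intro add_mono mult_right_mono) auto
  also have "\<dots> \<le> 2 / \<mu> * potential w"
    using gap_ge[of "fst w"] w mu_pos by (auto simp: potential_def field_simps)
  finally show ?thesis .
qed

text \<open>The potential contains the gap at \<open>y\<close>, not at the query point, so the gap
  is bounded through the distance to \<open>xstar\<close>, at the price of the factor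
  \<open>L / \<mu>\<close>.\<close>

lemma gap_query_le_potential:
  assumes w: "w \<in> Rd d \<times> Rd d"
  shows "f (query w) - f xstar \<le> L / \<mu> * potential w"
proof -
  have "f (query w) - f xstar \<le> L / 2 * (nrm d (query w - xstar))\<^sup>2"
    by (rule gap_le[OF query_Rd[OF w]])
  also have "\<dots> \<le> L / 2 * (2 / \<mu> * potential w)"
    using L_pos distance_query_le_potential[OF w] by (intro mult_left_mono) auto
  finally show ?thesis by simp
qed

lemma acgd_tuned_eq: "acgd_tuned d f L \<mu> x0 \<omega> \<C> k = distr (yz k) (Rd_borel d) query"
  by (simp add: acgd_tuned_def acgd_def yz_def query_def p_def s_def Let_def)

lemma prob_space_acgd_tuned: "prob_space (acgd_tuned d f L \<mu> x0 \<omega> \<C> k)"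
  unfolding acgd_tuned_eq
proof (rule prob_space.prob_space_distr)
  show "prob_space (yz k)" using yz_prob[of k] by (simp add: space_prob_algebra)
  show "query \<in> yz k \<rightarrow>\<^sub>M Rd_borel d"
    using measurable_query by (simp cong: measurable_cong_sets add: sets_yz)
qed

text \<open>Serves both error criteria. The bound is proved for the nonnegative integral; its
  finiteness yields integrability, and then the bound passes to the Bochner integral.\<close>

lemma expectation_acgd_tuned:
  assumes h: "h \<in> borel_measurable (Rd_borel d)" and nonneg: "\<And>x. x \<in> Rd d \<Longrightarrow> 0 \<le> h x"
    and c: "0 \<le> c" and le: "\<And>w. w \<in> Rd d \<times> Rd d \<Longrightarrow> h (query w) \<le> c * potential w"
  shows "integrable (acgd_tuned d f L \<mu> x0 \<omega> \<C> k) h"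
    and "(\<integral>x. h x \<partial>acgd_tuned d f L \<mu> x0 \<omega> \<C> k) \<le> c * ((1 - a) ^ k * potential (x0, x0))"
proof -
  let ?D = "acgd_tuned d f L \<mu> x0 \<omega> \<C> k"
  have q: "query \<in> yz k \<rightarrow>\<^sub>M Rd_borel d"
    using measurable_query by (simp cong: measurable_cong_sets add: sets_yz)
  have P: "(\<lambda>w. ennreal (potential w)) \<in> borel_measurable (yz k)"
    using measurable_potential by (simp cong: measurable_cong_sets add: sets_yz)
  have init: "0 \<le> (1 - a) ^ k * potential (x0, x0)"
    using a_le_1 x0 potential_nonneg[of "(x0, x0)"] by simp
  have "(\<integral>\<^sup>+x. ennreal (h x) \<partial>?D) = (\<integral>\<^sup>+w. ennreal (h (query w)) \<partial>yz k)"
    unfolding acgd_tuned_eq using measurable_compose[OF h measurable_ennreal]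
    by (intro nn_integral_distr[OF q]) simp
  also have "\<dots> \<le> (\<integral>\<^sup>+w. ennreal c * ennreal (potential w) \<partial>yz k)"
  proof (rule nn_integral_mono)
    fix w assume "w \<in> space (yz k)"
    then have w: "w \<in> Rd d \<times> Rd d" by (metis sets_eq_imp_space_eq sets_yz space_MM)
    show "ennreal (h (query w)) \<le> ennreal c * ennreal (potential w)"
      using ennreal_leI[OF le[OF w]] c potential_nonneg[OF w] by (simp add: ennreal_mult)
  qed
  also have "\<dots> = ennreal c * (\<integral>\<^sup>+w. ennreal (potential w) \<partial>yz k)"
    by (rule nn_integral_cmult[OF P])
  also have "\<dots> \<le> ennreal c * ennreal ((1 - a) ^ k * potential (x0, x0))"
    by (intro mult_left_mono expected_potential) simp
  also have "\<dots> = ennreal (c * ((1 - a) ^ k * potential (x0, x0)))"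
    using c init by (simp add: ennreal_mult)
  finally have bound: "(\<integral>\<^sup>+x. ennreal (h x) \<partial>?D) \<le> ennreal (c * ((1 - a) ^ k * potential (x0, x0)))" .
  have ae: "AE x in ?D. 0 \<le> h x"
    by (rule AE_I2) (simp add: acgd_tuned_eq nonneg)
  have hm: "h \<in> borel_measurable ?D" using h by (simp add: acgd_tuned_eq)
  show int: "integrable ?D h"
    using le_less_trans[OF bound ennreal_less_top] by (intro integrableI_nonneg hm ae) simp
  show "(\<integral>x. h x \<partial>?D) \<le> c * ((1 - a) ^ k * potential (x0, x0))"
    using bound c init unfolding nn_integral_eq_integral[OF int ae]
    by (subst (asm) ennreal_le_iff) auto
qed

lemma expected_distance:
  shows "integrable (acgd_tuned d f L \<mu> x0 \<omega> \<C> k) (\<lambda>x. (nrm d (x - xstar))\<^sup>2)"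
    and "(\<integral>x. (nrm d (x - xstar))\<^sup>2 \<partial>acgd_tuned d f L \<mu> x0 \<omega> \<C> k)
      \<le> 2 / \<mu> * ((1 - a) ^ k * potential (x0, x0))"
  using expectation_acgd_tuned[OF measurable_nrm_diff[of xstar], where c = "2 / \<mu>" and k = k]
    distance_query_le_potential mu_pos by auto

lemma expected_gap:
  shows "integrable (acgd_tuned d f L \<mu> x0 \<omega> \<C> k) f"
    and "(\<integral>x. f x \<partial>acgd_tuned d f L \<mu> x0 \<omega> \<C> k) - f xstar
      \<le> L / \<mu> * ((1 - a) ^ k * potential (x0, x0))"
proof -
  let ?D = "acgd_tuned d f L \<mu> x0 \<omega> \<C> k"
  interpret prob_space ?D by (rule prob_space_acgd_tuned)
  have "(\<lambda>x. f x - f xstar) \<in> borel_measurable (Rd_borel d)"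
    using measurable_objective by measurable
  note gap = expectation_acgd_tuned[OF this, where c = "L / \<mu>" and k = k]
  have int: "integrable ?D (\<lambda>x. f x - f xstar)"
    and le: "(\<integral>x. f x - f xstar \<partial>?D) \<le> L / \<mu> * ((1 - a) ^ k * potential (x0, x0))"
    using gap gap_query_le_potential minimizer mu_pos L_pos by auto
  \<comment> \<open>The general bound needs a nonnegative function, hence the gap; adding the
    constant back is harmless under a probability measure.\<close>
  have "integrable ?D (\<lambda>x. (f x - f xstar) + f xstar)"
    by (intro Bochner_Integration.integrable_add int) simp
  then show intf: "integrable ?D f" by simp
  show "(\<integral>x. f x \<partial>?D) - f xstar \<le> L / \<mu> * ((1 - a) ^ k * potential (x0, x0))"
    using le intf by (simp add: prob_space)
qed

text \<open>Since \<open>1 - a \<le> exp (- a)\<close>, the power is at most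
  \<open>exp (- (a * real k))\<close>, and \<open>a = s / p\<close> makes the hypothesis on
  \<open>k\<close> say that this is at most \<open>\<epsilon> / \<Delta>\<close>.\<close>

lemma contraction_le:
  assumes D: "0 < \<Delta>" and e: "0 < \<epsilon>" and k: "p / s * ln (\<Delta> / \<epsilon>) \<le> real k"
  shows "(1 - a) ^ k * \<Delta> \<le> \<epsilon>"
proof -
  have "ln (\<Delta> / \<epsilon>) \<le> a * real k"
    using k s_pos p_ge_1 by (simp add: a_def field_simps)
  then have "exp (- (a * real k)) \<le> exp (- ln (\<Delta> / \<epsilon>))" by simp
  also have "\<dots> = \<epsilon> / \<Delta>" using D e by (simp add: exp_minus)
  finally have "exp (- (a * real k)) \<le> \<epsilon> / \<Delta>" .
  moreover have "(1 - a) ^ k \<le> exp (- a) ^ k"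
    using a_le_1 exp_ge_add_one_self[of "- a"] by (intro power_mono) auto
  moreover have "exp (- a) ^ k = exp (- (a * real k))"
    by (simp add: exp_of_nat_mult[symmetric] mult.commute)
  ultimately have "(1 - a) ^ k \<le> \<epsilon> / \<Delta>" by simp
  then show ?thesis using D by (simp add: field_simps)
qed

end

text \<open>Quantifying \<open>\<Delta>\<close> before \<open>\<omega>\<close> and
  \<open>\<C>\<close> expresses its independence of them; the minimizer of a strongly convex
  function is unique, so dependence on \<open>xstar\<close> is dependence on \<open>f\<close>.
  Integrability is asserted because the integral of a nonintegrable function is 0 by
  convention.\<close>

theorem theorem3:
  shows "\<exists>C>0::real. \<forall>(d::nat) (f :: (nat \<Rightarrow> real) \<Rightarrow> real) (L::real) (\<mu>::real) x0 xstar.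
    0 < d \<longrightarrow> 0 < \<mu> \<longrightarrow> lipschitz_gradient d L f \<longrightarrow> strongly_convex d \<mu> f \<longrightarrow>
    x0 \<in> Rd d \<longrightarrow> xstar \<in> Rd d \<longrightarrow> (\<forall>x\<in>Rd d. f xstar \<le> f x) \<longrightarrow>
    (\<exists>\<Delta>>0::real. \<forall>(\<omega>::real) \<C>. 0 \<le> \<omega> \<longrightarrow> compression_operator d \<omega> \<C> \<longrightarrow>
      (\<forall>\<epsilon>. 0 < \<epsilon> \<longrightarrow> \<epsilon> < \<Delta> \<longrightarrow>
        (\<exists>k::nat. int k \<le> \<lceil>C * (1 + \<omega>) * sqrt (L / \<mu>) * ln (\<Delta> / \<epsilon>)\<rceil> \<and>
          integrable (acgd_tuned d f L \<mu> x0 \<omega> \<C> k) f \<and>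
          (\<integral>x. f x \<partial>acgd_tuned d f L \<mu> x0 \<omega> \<C> k) - f xstar \<le> \<epsilon>) \<and>
        (\<exists>k::nat. int k \<le> \<lceil>C * (1 + \<omega>) * sqrt (L / \<mu>) * ln (\<Delta> / \<epsilon>)\<rceil> \<and>
          integrable (acgd_tuned d f L \<mu> x0 \<omega> \<C> k) (\<lambda>x. (nrm d (x - xstar))\<^sup>2) \<and>
          (\<integral>x. (nrm d (x - xstar))\<^sup>2 \<partial>acgd_tuned d f L \<mu> x0 \<omega> \<C> k) \<le> \<epsilon>)))"
\<comment> \<open>The absolute constant is 1.\<close>
proof (rule exI[of _ 1], rule conjI[OF zero_less_one], intro allI impI, goal_cases)
  case (1 d f L \<mu> x0 xstar)
  then interpret smooth_strongly_convex d f L \<mu> xstar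
    by unfold_locales auto
  define \<Phi> where "\<Phi> = f x0 - f xstar + \<mu> / 2 * (nrm d (x0 - xstar))\<^sup>2"
  have \<Phi>: "0 \<le> \<Phi>" using 1 mu_pos by (simp add: \<Phi>_def)
  \<comment> \<open>The sum of the two conversion factors lets one \<open>\<Delta>\<close> serve
    both criteria; the summand 1 keeps it positive when \<open>x0\<close> is the minimizer.\<close>
  define \<Delta> where "\<Delta> = (L / \<mu> + 2 / \<mu>) * \<Phi> + 1"
  have \<Delta>: "0 < \<Delta>" "L / \<mu> * \<Phi> \<le> \<Delta>" "2 / \<mu> * \<Phi> \<le> \<Delta>"
  proof -
    have "0 \<le> L / \<mu> * \<Phi>" "0 \<le> 2 / \<mu> * \<Phi>" using \<Phi> L_pos mu_pos by simp_all
    then show "0 < \<Delta>" "L / \<mu> * \<Phi> \<le> \<Delta>" "2 / \<mu> * \<Phi> \<le> \<Delta>"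
      unfolding \<Delta>_def distrib_right by linarith+
  qed
  show ?case
  proof (rule exI[of _ \<Delta>], rule conjI[OF \<Delta>(1)], intro allI impI)
    fix \<omega> :: real and \<C> and \<epsilon> :: real
    assume *: "0 \<le> \<omega>" "compression_operator d \<omega> \<C>" and e: "0 < \<epsilon>" "\<epsilon> < \<Delta>"
    interpret tuned_acgd d f L \<mu> xstar x0 \<omega> \<C>
      by unfold_locales (use 1 * in auto)
    let ?r = "1 * (1 + \<omega>) * sqrt (L / \<mu>) * ln (\<Delta> / \<epsilon>)"
    define k where "k = nat \<lceil>?r\<rceil>"
    have r: "?r = p / s * ln (\<Delta> / \<epsilon>)"
      by (simp add: p_def s_def real_sqrt_divide)
    \<comment> \<open>Here \<open>\<epsilon> < \<Delta>\<close> makes the logarithm nonnegative, so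
      that \<open>nat\<close> does not truncate the ceiling.\<close>
    have "0 \<le> ?r" using *(1) e L_pos mu_pos by (intro mult_nonneg_nonneg) auto
    then have k: "int k = \<lceil>?r\<rceil>" by (simp add: k_def)
    have "?r \<le> real k" unfolding k_def by (rule real_nat_ceiling_ge)
    then have c: "(1 - a) ^ k * \<Delta> \<le> \<epsilon>"
      unfolding r by (rule contraction_le[OF \<Delta>(1) e(1)])
    have pot: "potential (x0, x0) = \<Phi>" by (simp add: potential_def \<Phi>_def)
    have small: "b * ((1 - a) ^ k * potential (x0, x0)) \<le> \<epsilon>" if "b * \<Phi> \<le> \<Delta>" for b
    proof -
      have "(1 - a) ^ k * (b * \<Phi>) \<le> (1 - a) ^ k * \<Delta>"
        using that a_le_1 by (intro mult_left_mono) auto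
      with c show ?thesis by (simp add: pot mult.left_commute)
    qed
    show "(\<exists>k. int k \<le> \<lceil>?r\<rceil> \<and> integrable (acgd_tuned d f L \<mu> x0 \<omega> \<C> k) f \<and>
          (\<integral>x. f x \<partial>acgd_tuned d f L \<mu> x0 \<omega> \<C> k) - f xstar \<le> \<epsilon>) \<and>
        (\<exists>k. int k \<le> \<lceil>?r\<rceil> \<and>
          integrable (acgd_tuned d f L \<mu> x0 \<omega> \<C> k) (\<lambda>x. (nrm d (x - xstar))\<^sup>2) \<and>
          (\<integral>x. (nrm d (x - xstar))\<^sup>2 \<partial>acgd_tuned d f L \<mu> x0 \<omega> \<C> k) \<le> \<epsilon>)"
    proof (intro conjI exI[of _ k])
      show "(\<integral>x. f x \<partial>acgd_tuned d f L \<mu> x0 \<omega> \<C> k) - f xstar \<le> \<epsilon>"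
        using expected_gap(2) small[OF \<Delta>(2)] by (rule order_trans)
      show "(\<integral>x. (nrm d (x - xstar))\<^sup>2 \<partial>acgd_tuned d f L \<mu> x0 \<omega> \<C> k) \<le> \<epsilon>"
        using expected_distance(2) small[OF \<Delta>(3)] by (rule order_trans)
    qed (simp_all only: k order_refl expected_gap(1) expected_distance(1))
  qed
qed

end
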